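(* Let $X$ be a non-empty set of positive integers with $X\neq\{1\}$. Both graphs $\Gamma(X)$ and $\Delta(X)$ are acyclic if and only if each connected component of $B(X)$ is a path or a cycle of length $4$.
   Context: For a non-empty set $X$ of positive integers, $\rho(X)$ is the set of primes dividing some element of $X$ and $X^*=X\setminus\{1\}$. $B(X)$ is the bipartite graph with vertex set the disjoint union $\rho(X)\cup X^*$ and edges $\{p,x\}$ for $p\in\rho(X)$, $x\in X^*$, $p\mid x$. $\Delta(X)$ has vertex set $\rho(X)$, distinct $p,q$ adjacent iff $pq$ divides some element of $X$. $\Gamma(X)$ has vertex set $X^*$, distinct $x,y$ adjacent iff $\gcd(x,y)>1$. A graph is acyclic if it contains no closed path of length at least $3$ (no cycle).
   Formalization: Since X may be infinite, "path" here includes one-way and two-way infinite paths; with finite paths only, the claim fails, e.g. for X = {p1p2, p2p3, p3p4, ...}, where B(X) is an infinite ray. For finite components it is the usual finite path. *)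

theory Defs
  imports
    "Graph_Theory.Graph_Theory"
    "HOL-Computational_Algebra.Primes"
begin

text \<open>
  Simple undirected graphs, possibly infinite, are represented as bidirected (symmetric,
  loop-free) digraphs without parallel arcs: an edge is a pair of opposite arcs.
\<close>

definition rho :: "nat set \<Rightarrow> nat set" where
  "rho X = {p. prime p \<and> (\<exists>x\<in>X. p dvd x)}"

definition star :: "nat set \<Rightarrow> nat set" where
  "star X = X - {1}"

text \<open>The two parts are tagged, since a prime may belong to both.\<close>

definition bipartite_divisor_graph :: "nat set \<Rightarrow> (nat + nat) pair_pre_digraph" where
  "bipartite_divisor_graph X =
    \<lparr> pverts = rho X <+> star X,
      parcs = {(Inl p, Inr x) |p x. p \<in> rho X \<and> x \<in> star X \<and> p dvd x}
            \<union> {(Inr x, Inl p) |p x. p \<in> rho X \<and> x \<in> star X \<and> p dvd x} \<rparr>"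

definition prime_vertex_graph :: "nat set \<Rightarrow> nat pair_pre_digraph" where
  "prime_vertex_graph X =
    \<lparr> pverts = rho X,
      parcs = {(p, q). p \<in> rho X \<and> q \<in> rho X \<and> p \<noteq> q \<and> (\<exists>x\<in>X. p * q dvd x)} \<rparr>"

definition common_divisor_graph :: "nat set \<Rightarrow> nat pair_pre_digraph" where
  "common_divisor_graph X =
    \<lparr> pverts = star X,
      parcs = {(x, y). x \<in> star X \<and> y \<in> star X \<and> x \<noteq> y \<and> gcd x y > 1} \<rparr>"

lemma pair_bidirected_bipartite_divisor_graph:
  "pair_bidirected_digraph (bipartite_divisor_graph X)"
  by unfold_locales
    (auto simp: bipartite_divisor_graph_def symmetric_def sym_def)

lemma pair_bidirected_prime_vertex_graph:
  "pair_bidirected_digraph (prime_vertex_graph X)"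
  by unfold_locales
    (auto simp: prime_vertex_graph_def symmetric_def sym_def mult.commute)

lemma pair_bidirected_common_divisor_graph:
  "pair_bidirected_digraph (common_divisor_graph X)"
  by unfold_locales
    (auto simp: common_divisor_graph_def symmetric_def sym_def gcd.commute)

text \<open>
  In a bidirected digraph every edge yields a directed cycle of length 2; the cycles of the
  underlying undirected graph are the directed cycles of length at least 3.
\<close>

definition acyclic_graph :: "('a, 'b) pre_digraph \<Rightarrow> bool" where
  "acyclic_graph G \<longleftrightarrow> \<not> (\<exists>c. pre_digraph.cycle G c \<and> length c \<ge> 3)"

text \<open>In a bidirected digraph the strongly connected components are the connected components.\<close>

definition connected_components :: "('a, 'b) pre_digraph \<Rightarrow> ('a, 'b) pre_digraph set" where
  "connected_components G = pre_digraph.sccs G"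

text \<open>
  A path graph has a non-empty interval of integers as its vertex set, consecutive integers being
  adjacent. An infinite graph may be a one-way or two-way infinite path; a finite one is
  a path in the usual sense.
\<close>

definition path_on :: "int set \<Rightarrow> int pair_pre_digraph" where
  "path_on I = \<lparr> pverts = I, parcs = {(i, j). i \<in> I \<and> j \<in> I \<and> \<bar>i - j\<bar> = 1} \<rparr>"

definition is_path :: "('a, 'b) pre_digraph \<Rightarrow> bool" where
  "is_path G \<longleftrightarrow>
    (\<exists>I. I \<noteq> {} \<and> (\<forall>i\<in>I. \<forall>k\<in>I. {i..k} \<subseteq> I) \<and> digraph_iso G (with_proj (path_on I)))"

lemma is_path_finite:
  assumes "is_path G" and "finite (verts G)"
  shows "\<exists>a b. a \<le> b \<and> digraph_iso G (with_proj (path_on {a..b}))"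
proof -
  obtain I where I: "I \<noteq> {}" "\<forall>i\<in>I. \<forall>k\<in>I. {i..k} \<subseteq> I" "digraph_iso G (with_proj (path_on I))"
    using assms(1) unfolding is_path_def by blast
  obtain f where f: "with_proj (path_on I) = app_iso f G"
    using I(3) unfolding digraph_iso_def by blast
  have "I = verts (with_proj (path_on I))"
    by (simp add: path_on_def)
  also have "\<dots> = iso_verts f ` verts G"
    unfolding f by (simp add: verts_app_iso)
  finally have "finite I"
    using assms(2) by simp
  then have "Min I \<in> I" "Max I \<in> I" "I \<subseteq> {Min I..Max I}"
    using I(1) by auto
  then have "Min I \<le> Max I" "I = {Min I..Max I}"
    using I(2) by (auto simp: subset_antisym)
  then show ?thesis
    using I(3) by metis
qed

definition cycle_on :: "nat \<Rightarrow> nat pair_pre_digraph" where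
  "cycle_on n =
    \<lparr> pverts = {..<n},
      parcs = {(i, j). i < n \<and> j < n \<and> (j = (i + 1) mod n \<or> i = (j + 1) mod n)} \<rparr>"

definition is_cycle_of_length :: "nat \<Rightarrow> ('a, 'b) pre_digraph \<Rightarrow> bool" where
  "is_cycle_of_length n G \<longleftrightarrow> n \<ge> 3 \<and> digraph_iso G (with_proj (cycle_on n))"

end

theory Submission
  imports Defs
begin

text \<open>
  Two primes are adjacent in \<open>\<Delta>(X)\<close>, and two elements in \<open>\<Gamma>(X)\<close>, exactly when they are distinct
  and have a common neighbour in \<open>B(X)\<close>. So \<open>\<Gamma>(X)\<close> and \<open>\<Delta>(X)\<close> together form the graph \<open>S\<close> of
  vertices at distance two in \<open>B(X)\<close>. Three neighbours of one vertex form a triangle in \<open>S\<close>; if \<open>S\<close>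
  is acyclic, all degrees in \<open>B(X)\<close> are therefore at most two, and every component is a path
  (possibly infinite) or a cycle. Walking around a cycle of length other than four in double
  steps gives a cycle in \<open>S\<close>. Conversely, a cycle in \<open>S\<close> lies over one component of \<open>B(X)\<close>. It
  cannot lie over a path, as its rightmost vertex has only one \<open>S\<close>-neighbour to the left, nor
  over a 4-cycle, where every vertex has only one \<open>S\<close>-neighbour.
\<close>

section \<open>Cycles as cyclic sequences of vertices\<close>

text \<open>Indices modulo \<open>n\<close> replace arc lists, so that double steps, rotations and
  images under vertex maps become index computations.\<close>

definition cyclic_seq :: "'a rel \<Rightarrow> nat \<Rightarrow> (nat \<Rightarrow> 'a) \<Rightarrow> bool" where
  "cyclic_seq E n g \<longleftrightarrow> 3 \<le> n \<and> inj_on g {..<n} \<and> (\<forall>i<n. (g i, g (Suc i mod n)) \<in> E)"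

text \<open>For the arcs of B(X) this is the graph \<open>S\<close>. The diagonal is removed since
  going to a neighbour and back returns to the start.\<close>

definition square :: "'a rel \<Rightarrow> 'a rel" where
  "square E = {(u, w). u \<noteq> w \<and> (u, w) \<in> E O E}"

lemma sym_square: "sym E \<Longrightarrow> sym (square E)"
  unfolding square_def sym_def by blast

text \<open>Replaces the recursion by local conditions on indices, the form in which walks can be
  compared with cyclic sequences.\<close>

lemma pcas_conv_nth:
  "c \<noteq> [] \<Longrightarrow> pcas u c v \<longleftrightarrow>
    fst (hd c) = u \<and> snd (last c) = v \<and> (\<forall>i. Suc i < length c \<longrightarrow> snd (c ! i) = fst (c ! Suc i))"
proof (induction c arbitrary: u)
  case (Cons e c)
  show ?case
  proof (cases "c = []")
    case False
    then show ?thesis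
      using Cons.IH[OF False, of "snd e"]
      by (auto simp: nth_Cons hd_conv_nth split: nat.splits)
  qed auto
qed simp

text \<open>The heads of the arcs of a cycle form a cyclic sequence; conversely, the arcs joining
  consecutive terms form a cycle.\<close>

lemma acyclic_graph_iff_cyclic_seq:
  assumes "pair_wf_digraph G"
  shows "acyclic_graph (with_proj G) \<longleftrightarrow> (\<nexists>n g. cyclic_seq (parcs G) n g)"
proof -
  interpret pair_wf_digraph G by fact
  have cycle_iff: "cycle c \<longleftrightarrow>
      (\<exists>u. u \<in> pverts G \<and> set c \<subseteq> parcs G \<and> pcas u c u \<and> distinct (tl (pawalk_verts u c)) \<and> c \<noteq> [])" for c
    by (auto simp: cycle_def awalk_def)
  have "\<exists>n g. cyclic_seq (parcs G) n g" if c: "cycle c" "3 \<le> length c" for c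
  proof -
    obtain u where u: "set c \<subseteq> parcs G" "pcas u c u" "distinct (tl (pawalk_verts u c))" "c \<noteq> []"
      using c(1) unfolding cycle_iff by blast
    \<comment> \<open>The start \<open>u\<close> recurs as the last head; dropping the first vertex,
      as the definition of a cycle does, leaves exactly the arc heads.\<close>
    have "pawalk_verts u c = u # map snd c"
      using awalk_verts_conv'[OF u(2)] u(2,4) by (cases c) auto
    then have dist: "distinct (map snd c)"
      using u(3) by simp
    have step: "snd (c ! i) = fst (c ! (Suc i mod length c))" if "i < length c" for i
    proof (cases "Suc i < length c")
      case True
      then show ?thesis
        using u(2,4) by (simp add: pcas_conv_nth)
    next
      case False
      then have "Suc i = length c"
        using that by simp
      moreover from this have "c ! i = last c"
        using u(4) by (simp add: last_conv_nth flip: \<open>Suc i = length c\<close>)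
      ultimately show ?thesis
        using u(2,4) by (simp add: pcas_conv_nth hd_conv_nth)
    qed
    have "cyclic_seq (parcs G) (length c) (\<lambda>i. snd (c ! i))"
      unfolding cyclic_seq_def
    proof (intro conjI allI impI)
      show "inj_on (\<lambda>i. snd (c ! i)) {..<length c}"
        using dist by (auto simp: inj_on_def distinct_conv_nth)
    next
      fix i assume "i < length c"
      moreover from this have "c ! (Suc i mod length c) \<in> parcs G"
        using u(1,4) by (metis length_greater_0_conv mod_less_divisor nth_mem subsetD)
      ultimately show "(snd (c ! i), snd (c ! (Suc i mod length c))) \<in> parcs G"
        using step by simp
    qed (fact c)
    then show ?thesis by blast
  qed
  moreover have "\<exists>c. cycle c \<and> 3 \<le> length c" if g: "cyclic_seq (parcs G) n g" for n g
  proof -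
    define c where "c = map (\<lambda>i. (g i, g (Suc i mod n))) [0..<n]"
    have n: "3 \<le> n" "inj_on g {..<n}" and arcs: "\<And>i. i < n \<Longrightarrow> (g i, g (Suc i mod n)) \<in> parcs G"
      using g by (auto simp: cyclic_seq_def)
    have len: "length c = n" and "c \<noteq> []"
      using n by (auto simp: c_def)
    have cas: "pcas (g 0) c (g 0)"
      using n(1) \<open>c \<noteq> []\<close> by (auto simp: pcas_conv_nth c_def hd_map last_map)
    have "tl (pawalk_verts (g 0) c) = map (\<lambda>i. g (Suc i mod n)) [0..<n]"
      using awalk_verts_conv'[OF cas] \<open>c \<noteq> []\<close> by (simp add: c_def)
    \<comment> \<open>The heads list the sequence from \<open>g 1\<close> on, with
      \<open>g 0\<close> last, a rotation that keeps the terms distinct.\<close>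
    moreover have "inj_on (\<lambda>i. g (Suc i mod n)) {..<n}"
    proof (rule inj_onI)
      fix i j assume ij: "i \<in> {..<n}" "j \<in> {..<n}" "g (Suc i mod n) = g (Suc j mod n)"
      then have "Suc i mod n = Suc j mod n"
        using n by (auto dest: inj_onD)
      then show "i = j"
        using ij by (auto simp: mod_Suc split: if_splits)
    qed
    ultimately have "distinct (tl (pawalk_verts (g 0) c))"
      by (simp add: distinct_map atLeast0LessThan)
    moreover have "set c \<subseteq> parcs G"
      using arcs by (auto simp: c_def)
    moreover have "g 0 \<in> pverts G"
      using arcs[of 0] n(1) by (auto dest: in_arcsD1)
    ultimately show ?thesis
      using cas \<open>c \<noteq> []\<close> len n(1) unfolding cycle_iff by auto
  qed
  ultimately show ?thesis
    unfolding acyclic_graph_def by blast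
qed

text \<open>The conditions on \<open>h\<close> concern visited vertices only: \<open>projl\<close>
  and \<open>projr\<close> are meaningful on one side of B(X), an isomorphism on one
  component.\<close>

lemma cyclic_seq_map:
  assumes "cyclic_seq R n g" and "inj_on h (g ` {..<n})"
    and "\<And>u v. u \<in> g ` {..<n} \<Longrightarrow> v \<in> g ` {..<n} \<Longrightarrow> (u, v) \<in> R \<Longrightarrow> (h u, h v) \<in> R'"
  shows "cyclic_seq R' n (h \<circ> g)"
proof -
  have "Suc i mod n < n" if "i < n" for i
    using that by simp
  then show ?thesis
    using assms unfolding cyclic_seq_def by (auto intro: comp_inj_on)
qed

text \<open>The cyclic predecessor and successor of a position are different because
  \<open>n\<close> is at least 3.\<close>

lemma cyclic_seq_two_neighbours:
  assumes "cyclic_seq E n g" and "sym E" and "i < n"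
  obtains j k where "j < n" "k < n" "g j \<noteq> g k" "(g i, g j) \<in> E" "(g i, g k) \<in> E"
proof -
  define j where "j = (if i = 0 then n - 1 else i - 1)"
  have n: "3 \<le> n" "inj_on g {..<n}" and arcs: "\<And>i. i < n \<Longrightarrow> (g i, g (Suc i mod n)) \<in> E"
    using assms(1) by (auto simp: cyclic_seq_def)
  have j: "j < n" "Suc j mod n = i" "Suc i mod n < n" "j \<noteq> Suc i mod n"
    using n(1) \<open>i < n\<close> by (auto simp: j_def mod_Suc)
  show ?thesis
  proof (rule that)
    show "g j \<noteq> g (Suc i mod n)"
      using j n(2) by (auto dest: inj_onD)
    show "(g i, g j) \<in> E"
      using arcs[OF j(1)] j(2) \<open>sym E\<close> by (auto dest: symD)
  qed (use j arcs \<open>i < n\<close> in auto)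
qed

section \<open>Double steps around a cycle\<close>

text \<open>Walk around the cycle in steps of length two: this visits all vertices if \<open>n\<close> is odd and
  every other vertex if \<open>n\<close> is even; for \<open>n = 4\<close> the resulting closed walk is too short.\<close>

lemma cyclic_seq_square:
  assumes g: "cyclic_seq E n g" and "n \<noteq> 4"
  shows "\<exists>m h. cyclic_seq (square E) m h"
proof -
  \<comment> \<open>\<open>m\<close> is the additive order of 2 modulo \<open>n\<close>, the number
    of double steps before the walk closes. For \<open>n \<ge> 3\<close> only \<open>n = 4\<close>
    gives \<open>m < 3\<close>.\<close>
  define m where "m = (if even n then n div 2 else n)"
  define h where "h = (\<lambda>k. g (2 * k mod n))"
  have n: "3 \<le> n" "inj_on g {..<n}" and arcs: "\<And>i. i < n \<Longrightarrow> (g i, g (Suc i mod n)) \<in> E"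
    using g by (auto simp: cyclic_seq_def)
  have m: "3 \<le> m"
    using n(1) \<open>n \<noteq> 4\<close> unfolding m_def by (cases "even n") (auto elim!: evenE)
  have dvd_half: "m dvd d" if "n dvd 2 * d" for d
  proof (cases "even n")
    case False
    then have "coprime n 2" by simp
    then show ?thesis
      using that False by (simp add: m_def coprime_dvd_mult_right_iff)
  qed (use that in \<open>auto simp: m_def elim!: evenE\<close>)
  have less_neq: "2 * i mod n \<noteq> 2 * j mod n" if "i < j" "j < m" for i j
  proof
    assume "2 * i mod n = 2 * j mod n"
    then have "n dvd 2 * j - 2 * i"
      by (metis mod_eq_dvd_iff_nat mult_le_mono2 less_imp_le that(1))
    then have "m dvd j - i"
      by (intro dvd_half) (simp add: right_diff_distrib')
    then show False
      using that by (auto dest: dvd_imp_le)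
  qed
  have inj: "inj_on h {..<m}"
  proof (rule inj_onI)
    fix i j assume ij: "i \<in> {..<m}" "j \<in> {..<m}" "h i = h j"
    have "2 * i mod n < n" "2 * j mod n < n"
      using n(1) by auto
    then have "2 * i mod n = 2 * j mod n"
      using ij(3) n(2) by (auto simp: h_def dest: inj_onD)
    then show "i = j"
      using less_neq[of i j] less_neq[of j i] ij(1,2) by (cases i j rule: linorder_cases) auto
  qed
  \<comment> \<open>\<open>2 * m\<close> is a multiple of \<open>n\<close>, so reducing the step
    counter modulo \<open>m\<close> does not change the vertex.\<close>
  have wrap: "2 * (k mod m) mod n = 2 * k mod n" for k
  proof (cases "even n")
    case True
    then obtain l where "n = 2 * l" by (elim evenE)
    then show ?thesis
      by (simp add: m_def flip: mult_mod_right)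
  qed (simp add: m_def mod_mult_right_eq)
  have "(h k, h (Suc k mod m)) \<in> square E" if "k < m" for k
  proof -
    have "Suc k mod m \<noteq> k" "Suc k mod m < m"
      using that m by (auto simp: mod_Suc)
    then have "h k \<noteq> h (Suc k mod m)"
      using inj that by (auto dest: inj_onD)
    \<comment> \<open>The vertex passed over in the middle of the double step is the common
      neighbour.\<close>
    moreover have "(h k, g (Suc (2 * k) mod n)) \<in> E"
      using arcs[of "2 * k mod n"] n(1) by (simp add: h_def mod_Suc_eq)
    moreover have "(g (Suc (2 * k) mod n), h (Suc k mod m)) \<in> E"
      using arcs[of "Suc (2 * k) mod n"] n(1) wrap[of "Suc k"] by (simp add: h_def mod_Suc_eq)
    ultimately show ?thesis
      unfolding square_def by blast
  qed
  then show ?thesis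
    using m inj unfolding cyclic_seq_def by blast
qed

section \<open>Squares of paths and of the 4-cycle\<close>

text \<open>The only possible square neighbours of \<open>a\<close> are \<open>a - 2\<close> and
  \<open>a + 2\<close>. A cyclic sequence visits finitely many integers, even if \<open>I\<close> is
  infinite; the largest one would need two neighbours below it.\<close>

lemma no_cyclic_seq_square_path_on: "\<not> cyclic_seq (square (parcs (path_on I))) n g"
proof
  assume g: "cyclic_seq (square (parcs (path_on I))) n g"
  have "sym (parcs (path_on I))"
    by (auto simp: path_on_def sym_def abs_minus_commute)
  then have sym: "sym (square (parcs (path_on I)))"
    by (rule sym_square)
  have dist: "b = a - 2 \<or> b = a + 2" if "(a, b) \<in> square (parcs (path_on I))" for a b
    using that unfolding square_def path_on_def by auto
  have "finite (g ` {..<n})" "g ` {..<n} \<noteq> {}"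
    using g by (auto simp: cyclic_seq_def lessThan_empty_iff)
  then have "Max (g ` {..<n}) \<in> g ` {..<n}" and max: "\<And>i. i < n \<Longrightarrow> g i \<le> Max (g ` {..<n})"
    by (auto intro: Max_in)
  then obtain i where i: "i < n" "g i = Max (g ` {..<n})"
    by auto
  obtain j k where jk: "j < n" "k < n" "g j \<noteq> g k"
      "(g i, g j) \<in> square (parcs (path_on I))" "(g i, g k) \<in> square (parcs (path_on I))"
    using cyclic_seq_two_neighbours[OF g sym i(1)] by blast
  then show False
    using dist[OF jk(4)] dist[OF jk(5)] max[OF jk(1)] max[OF jk(2)] i(2) by auto
qed

lemma no_cyclic_seq_square_cycle_on_4: "\<not> cyclic_seq (square (parcs (cycle_on 4))) n g"
proof
  assume g: "cyclic_seq (square (parcs (cycle_on 4))) n g"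
  then have "0 < n"
    by (simp add: cyclic_seq_def)
  have "sym (parcs (cycle_on 4))"
    by (auto simp: cycle_on_def sym_def)
  then have sym: "sym (square (parcs (cycle_on 4)))"
    by (rule sym_square)
  have opposite: "a < 4 \<and> b < 4 \<and> (b = a + 2 \<or> a = b + 2)"
    if "(a, b) \<in> square (parcs (cycle_on 4))" for a b
  proof -
    from that obtain c where "a \<noteq> b" "a < 4" "b < 4" "c < 4"
      and "c = Suc a mod 4 \<or> a = Suc c mod 4" "b = Suc c mod 4 \<or> c = Suc b mod 4"
      unfolding square_def cycle_on_def by auto
    then show ?thesis
      by (auto simp: mod_Suc split: if_splits)
  qed
  obtain j k where jk: "g j \<noteq> g k" "(g 0, g j) \<in> square (parcs (cycle_on 4))"
      "(g 0, g k) \<in> square (parcs (cycle_on 4))"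
    using cyclic_seq_two_neighbours[OF g sym \<open>0 < n\<close>] by blast
  then show False
    using opposite[OF jk(2)] opposite[OF jk(3)] by auto
qed

section \<open>Isomorphisms as bijections of vertices\<close>

text \<open>An isomorphism also maps arcs and carries head and tail functions; here an arc is the
  pair of its ends, so the vertex map determines the rest.\<close>

lemma digraph_iso_with_proj_iff:
  assumes "pair_wf_digraph G" and "pair_wf_digraph H"
  shows "digraph_iso (with_proj G) (with_proj H) \<longleftrightarrow>
    (\<exists>f. bij_betw f (pverts G) (pverts H) \<and>
      (\<forall>u\<in>pverts G. \<forall>v\<in>pverts G. (u, v) \<in> parcs G \<longleftrightarrow> (f u, f v) \<in> parcs H))"
proof
  interpret G: pair_wf_digraph G by fact
  interpret H: pair_wf_digraph H by fact
  {
    assume "digraph_iso (with_proj G) (with_proj H)"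
    then obtain \<phi> where iso: "G.digraph_isomorphism \<phi>" and H: "with_proj H = app_iso \<phi> (with_proj G)"
      unfolding digraph_iso_def by blast
    let ?f = "iso_verts \<phi>"
    have inj: "inj_on ?f (pverts G)" and ends:
      "\<And>a. a \<in> parcs G \<Longrightarrow> ?f (fst a) = iso_tail \<phi> (iso_arcs \<phi> a) \<and> ?f (snd a) = iso_head \<phi> (iso_arcs \<phi> a)"
      using iso by (auto simp: G.digraph_isomorphism_def)
    \<comment> \<open>Equating the tail and head functions forces those of the isomorphism to be
      \<open>fst\<close> and \<open>snd\<close>, so arcs are mapped componentwise.\<close>
    have "verts (with_proj H) = verts (app_iso \<phi> (with_proj G))"
      "arcs (with_proj H) = arcs (app_iso \<phi> (with_proj G))"
      "tail (with_proj H) = tail (app_iso \<phi> (with_proj G))"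
      "head (with_proj H) = head (app_iso \<phi> (with_proj G))"
      by (simp_all only: H)
    then have V: "pverts H = ?f ` pverts G" and A: "parcs H = iso_arcs \<phi> ` parcs G"
      and th: "iso_tail \<phi> = fst" "iso_head \<phi> = snd"
      by simp_all
    have arc: "iso_arcs \<phi> (u, v) = (?f u, ?f v)" if "(u, v) \<in> parcs G" for u v
      using ends[OF that] by (simp add: th prod_eq_iff)
    have "(u, v) \<in> parcs G \<longleftrightarrow> (?f u, ?f v) \<in> parcs H" if uv: "u \<in> pverts G" "v \<in> pverts G" for u v
    proof
      assume "(?f u, ?f v) \<in> parcs H"
      then obtain u' v' where "(u', v') \<in> parcs G" "?f u = ?f u'" "?f v = ?f v'"
        unfolding A using arc by auto
      then show "(u, v) \<in> parcs G"
        using inj uv by (metis G.in_arcsD1 G.in_arcsD2 inj_onD)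
    qed (use arc A in force)
    then show "\<exists>f. bij_betw f (pverts G) (pverts H) \<and>
      (\<forall>u\<in>pverts G. \<forall>v\<in>pverts G. (u, v) \<in> parcs G \<longleftrightarrow> (f u, f v) \<in> parcs H)"
      using inj V by (intro exI[of _ ?f]) (auto simp: bij_betw_def)
  next
    assume "\<exists>f. bij_betw f (pverts G) (pverts H) \<and>
      (\<forall>u\<in>pverts G. \<forall>v\<in>pverts G. (u, v) \<in> parcs G \<longleftrightarrow> (f u, f v) \<in> parcs H)"
    then obtain f where inj: "inj_on f (pverts G)" and V: "pverts H = f ` pverts G"
      and A: "\<And>u v. u \<in> pverts G \<Longrightarrow> v \<in> pverts G \<Longrightarrow> (u, v) \<in> parcs G \<longleftrightarrow> (f u, f v) \<in> parcs H"
      by (auto simp: bij_betw_def)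
    define \<phi> where "\<phi> = \<lparr>iso_verts = f, iso_arcs = map_prod f f, iso_head = snd, iso_tail = fst\<rparr>"
    have "parcs G \<subseteq> pverts G \<times> pverts G"
      by (auto dest: G.in_arcsD1 G.in_arcsD2)
    then have "inj_on (map_prod f f) (parcs G)"
      using map_prod_inj_on[OF inj inj] by (rule inj_on_subset[rotated])
    then have "G.digraph_isomorphism \<phi>"
      using inj G.wf_digraph_axioms by (auto simp: G.digraph_isomorphism_def \<phi>_def)
    moreover have "parcs H = map_prod f f ` parcs G"
    proof (intro equalityI subsetI)
      fix e assume "e \<in> parcs H"
      moreover obtain u v where "e = (f u, f v)" "u \<in> pverts G" "v \<in> pverts G"
        using H.arc_fst_in_verts[OF \<open>e \<in> parcs H\<close>] H.arc_snd_in_verts[OF \<open>e \<in> parcs H\<close>]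
        unfolding V by (metis imageE prod.collapse)
      ultimately show "e \<in> map_prod f f ` parcs G"
        using A by force
    next
      fix e assume "e \<in> map_prod f f ` parcs G"
      then obtain u v where "e = (f u, f v)" "(u, v) \<in> parcs G"
        by auto
      then show "e \<in> parcs H"
        using A[of u v] by (auto dest: G.in_arcsD1 G.in_arcsD2)
    qed
    then have "with_proj H = app_iso \<phi> (with_proj G)"
      using V by (simp add: with_proj_def app_iso_def \<phi>_def)
    ultimately show "digraph_iso (with_proj G) (with_proj H)"
      unfolding digraph_iso_def by blast
  }
qed

section \<open>Components of graphs of maximum degree two\<close>

text \<open>An injective walk indexed by an interval of integers is encoded by its graph, so that
  Zorn's lemma for inclusion yields a maximal one.\<close>

definition partial_path :: "'a rel \<Rightarrow> (int \<times> 'a) set \<Rightarrow> bool" where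
  "partial_path E R \<longleftrightarrow> (\<forall>i u j v. (i, u) \<in> R \<longrightarrow> (j, v) \<in> R \<longrightarrow>
    (i = j \<longleftrightarrow> u = v) \<and> (j = i + 1 \<longrightarrow> (u, v) \<in> E) \<and> {i..j} \<subseteq> Domain R)"

text \<open>The equivalence has two uses: left to right \<open>R\<close> is single-valued, right to
  left it is injective.\<close>

lemma partial_pathD:
  assumes "partial_path E R" and "(i, u) \<in> R" and "(j, v) \<in> R"
  shows "i = j \<longleftrightarrow> u = v" and "j = i + 1 \<Longrightarrow> (u, v) \<in> E" and "{i..j} \<subseteq> Domain R"
  using assms unfolding partial_path_def by metis+

text \<open>Every condition involves only two pairs, and two members of a chain are comparable, so
  both pairs lie in one partial path.\<close>

lemma partial_path_Union_chain:
  assumes chain: "subset.chain {R. partial_path E R} \<C>"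
  shows "partial_path E (\<Union>\<C>)"
  unfolding partial_path_def
proof (intro allI impI)
  fix i u j v assume "(i, u) \<in> \<Union>\<C>" "(j, v) \<in> \<Union>\<C>"
  then obtain P Q where PQ: "P \<in> \<C>" "(i, u) \<in> P" "Q \<in> \<C>" "(j, v) \<in> Q"
    by blast
  then have "P \<subseteq> Q \<or> Q \<subseteq> P"
    using chain by (auto simp: subset.chain_def)
  then obtain R where R: "R \<in> \<C>" "(i, u) \<in> R" "(j, v) \<in> R"
    using PQ by blast
  then have "partial_path E R"
    using chain by (auto simp: subset.chain_def)
  note D = partial_pathD[OF this R(2,3)]
  have "Domain R \<subseteq> Domain (\<Union>\<C>)"
    using R(1) by blast
  then show "(i = j \<longleftrightarrow> u = v) \<and> (j = i + 1 \<longrightarrow> (u, v) \<in> E) \<and> {i..j} \<subseteq> Domain (\<Union>\<C>)"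
    using D by simp
qed

text \<open>The index \<open>c\<close> lies just beyond the end \<open>b\<close> of the domain, so
  the only new adjacency to check is that of \<open>u\<close> and \<open>w\<close>.\<close>

lemma partial_path_insert:
  assumes R: "partial_path E R" and "sym E"
    and b: "(b, u) \<in> R" and c: "\<bar>c - b\<bar> = 1" "c \<notin> Domain R"
    and w: "(u, w) \<in> E" "w \<notin> Range R"
  shows "partial_path E (insert (c, w) R)"
proof -
  have up: "{i..c} \<subseteq> insert c (Domain R)" and down: "{c..i} \<subseteq> insert c (Domain R)"
    if "(i, v) \<in> R" for i v
  proof -
    have "{i..c} \<subseteq> insert c {i..b}" "{c..i} \<subseteq> insert c {b..i}"
      using c(1) by auto
    then show "{i..c} \<subseteq> insert c (Domain R)" "{c..i} \<subseteq> insert c (Domain R)"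
      using partial_pathD(3)[OF R that b] partial_pathD(3)[OF R b that] by auto
  qed
  have adj: "(v, w) \<in> E" if "(j, v) \<in> R" "\<bar>c - j\<bar> = 1" for j v
  proof -
    \<comment> \<open>An index \<open>j\<close> on the far side of \<open>c\<close> would put
      \<open>c\<close> into the domain, which is an interval.\<close>
    have "j = b \<or> c \<in> {b..j} \<or> c \<in> {j..b}"
      using c(1) that(2) by auto
    then have "j = b"
      using partial_pathD(3)[OF R that(1) b] partial_pathD(3)[OF R b that(1)] c(2) by auto
    then show ?thesis
      using partial_pathD(1)[OF R b that(1)] w(1) by simp
  qed
  show ?thesis
    unfolding partial_path_def
  proof (intro allI impI)
    fix i v j v'
    assume "(i, v) \<in> insert (c, w) R" "(j, v') \<in> insert (c, w) R"
    then consider "(i, v) \<in> R" "(j, v') \<in> R" | "(i, v) \<in> R" "j = c" "v' = w"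
      | "(j, v') \<in> R" "i = c" "v = w" | "i = c" "v = w" "j = c" "v' = w"
      by auto
    then show "(i = j \<longleftrightarrow> v = v') \<and> (j = i + 1 \<longrightarrow> (v, v') \<in> E) \<and>
      {i..j} \<subseteq> Domain (insert (c, w) R)"
    proof cases
      case 1
      then show ?thesis
        using partial_pathD[OF R 1] by auto
    next
      case 2
      then have "i \<noteq> c" "v \<noteq> w"
        using c(2) w(2) by auto
      then show ?thesis
        using 2 up[OF 2(1)] adj[OF 2(1)] by auto
    next
      case 3
      then have "j \<noteq> c" "v' \<noteq> w"
        using c(2) w(2) by auto
      then show ?thesis
        using 3 down[OF 3(1)] adj[OF 3(1)] \<open>sym E\<close> by (auto dest: symD)
    qed auto
  qed
qed

text \<open>Take a maximal path through \<open>v\<close>. Inner vertices have both their neighbours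
  on it and the ends cannot be continued, so it is closed under adjacency; an extra arc can only
  join its two ends. Zorn's lemma is used because the path may be infinite.\<close>

lemma component_of_max_degree_2:
  fixes E :: "'a rel"
  assumes "sym E" and irrefl: "\<And>u. (u, u) \<notin> E"
    and deg: "\<And>v a b c. (v, a) \<in> E \<Longrightarrow> (v, b) \<in> E \<Longrightarrow> (v, c) \<in> E \<Longrightarrow> a = b \<or> a = c \<or> b = c"
  obtains I :: "int set" and f where "\<forall>i\<in>I. \<forall>k\<in>I. {i..k} \<subseteq> I" "inj_on f I" "v \<in> f ` I"
    "E `` (f ` I) \<subseteq> f ` I"
    "(\<forall>i\<in>I. \<forall>j\<in>I. (f i, f j) \<in> E \<longleftrightarrow> \<bar>i - j\<bar> = 1) \<or>
     (\<exists>a b. a + 2 \<le> b \<and> I = {a..b} \<and>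
       (\<forall>i\<in>I. \<forall>j\<in>I. (f i, f j) \<in> E \<longleftrightarrow> \<bar>i - j\<bar> = 1 \<or> {i, j} = {a, b}))"
proof -
  define \<A> where "\<A> = {R. partial_path E R \<and> ((0::int), v) \<in> R}"
  have "\<exists>R\<in>\<A>. \<forall>Q\<in>\<A>. R \<subseteq> Q \<longrightarrow> Q = R"
  proof (rule subset_Zorn_nonempty)
    have "partial_path E {(0, v)}"
      by (auto simp: partial_path_def)
    then show "\<A> \<noteq> {}"
      by (auto simp: \<A>_def)
    fix \<C> assume \<C>: "\<C> \<noteq> {}" "subset.chain \<A> \<C>"
    then have "subset.chain {R. partial_path E R} \<C>"
      by (auto simp: subset.chain_def \<A>_def)
    then have "partial_path E (\<Union>\<C>)"
      by (rule partial_path_Union_chain)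
    then show "\<Union>\<C> \<in> \<A>"
      using \<C> by (auto simp: subset.chain_def \<A>_def)
  qed
  \<comment> \<open>Supersets of \<open>R\<close> keep the pair \<open>(0, v)\<close>, so
    \<open>R\<close> is maximal among all partial paths.\<close>
  then obtain R where R: "partial_path E R" "(0, v) \<in> R"
    and max: "\<And>Q. partial_path E Q \<Longrightarrow> R \<subseteq> Q \<Longrightarrow> Q = R"
    unfolding \<A>_def by blast
  note D = partial_pathD[OF R(1)]
  have maximal: "w \<in> Range R" if "(b, u) \<in> R" "\<bar>c - b\<bar> = 1" "c \<notin> Domain R" "(u, w) \<in> E" for b c u w
  proof (rule ccontr)
    assume "w \<notin> Range R"
    from max[OF partial_path_insert[OF R(1) \<open>sym E\<close> that(1,2,3,4) this]] have "(c, w) \<in> R"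
      by blast
    then show False
      using that(3) by blast
  qed
  have inner: "w = x \<or> w = y"
    if "(i, u) \<in> R" "(i - 1, x) \<in> R" "(i + 1, y) \<in> R" "(u, w) \<in> E" for i u x y w
  proof -
    have "(u, x) \<in> E" "(u, y) \<in> E"
      using D(2)[OF that(2,1)] D(2)[OF that(1,3)] \<open>sym E\<close> by (auto dest: symD)
    moreover have "x \<noteq> y"
      using D(1)[OF that(2,3)] by simp
    ultimately show ?thesis
      using deg[of u w x y] that(4) by blast
  qed
  have closed: "w \<in> Range R" if "(i, u) \<in> R" "(u, w) \<in> E" for i u w
  proof (cases "i - 1 \<in> Domain R \<and> i + 1 \<in> Domain R")
    case True
    then show ?thesis
      using inner[OF that(1) _ _ that(2)] by blast
  next
    case False
    then show ?thesis
      using maximal[OF that(1), of "i - 1"] maximal[OF that(1), of "i + 1"] that(2) by auto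
  qed
  \<comment> \<open>If one end of the arc has both adjacent positions in use, the degree bound
    leaves only these for the other end.\<close>
  have ends: "j = i + 1 \<or> i - 1 \<notin> Domain R \<and> j + 1 \<notin> Domain R"
    if "(i, u) \<in> R" "(j, w) \<in> R" "(u, w) \<in> E" "i < j" for i j u w
  proof (rule disjCI)
    assume *: "\<not> (i - 1 \<notin> Domain R \<and> j + 1 \<notin> Domain R)"
    have "{i + 1, j - 1} \<subseteq> {i..j}"
      using that(4) by auto
    then have "{i + 1, j - 1} \<subseteq> Domain R"
      using D(3)[OF that(1,2)] by blast
    then obtain x y where xy: "(i + 1, x) \<in> R" "(j - 1, y) \<in> R"
      by blast
    show "j = i + 1"
    proof (cases "i - 1 \<in> Domain R")
      case True
      then obtain z where z: "(i - 1, z) \<in> R" by blast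
      from inner[OF that(1) z xy(1) that(3)] show ?thesis
        using D(1)[OF that(2) z] D(1)[OF that(2) xy(1)] that(4) by auto
    next
      case False
      then obtain z where z: "(j + 1, z) \<in> R"
        using * by blast
      have "(w, u) \<in> E"
        using that(3) \<open>sym E\<close> by (auto dest: symD)
      from inner[OF that(2) xy(2) z this] show ?thesis
        using D(1)[OF that(1) z] D(1)[OF that(1) xy(2)] that(4) by auto
    qed
  qed
  define I where "I = Domain R"
  obtain f where f: "\<And>i. i \<in> I \<Longrightarrow> (i, f i) \<in> R"
    using bchoice[of I "\<lambda>i u. (i, u) \<in> R"] unfolding I_def by blast
  have int: "\<forall>i\<in>I. \<forall>k\<in>I. {i..k} \<subseteq> I"
    using D(3) unfolding I_def by blast
  have inj: "inj_on f I"
    by (rule inj_onI) (use f D(1) in metis)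
  have range: "Range R = f ` I"
  proof (intro equalityI subsetI)
    fix w assume "w \<in> Range R"
    then obtain i where i: "(i, w) \<in> R" by blast
    then have "i \<in> I"
      by (auto simp: I_def)
    then show "w \<in> f ` I"
      using D(1)[OF i f] by blast
  qed (use f in blast)
  have adj: "(f i, f j) \<in> E" if "i \<in> I" "j \<in> I" "\<bar>i - j\<bar> = 1" for i j
  proof -
    have "j = i + 1 \<or> i = j + 1"
      using that(3) by auto
    then show ?thesis
      using D(2) f that \<open>sym E\<close> by (metis symD)
  qed
  show thesis
  proof (rule that[OF int inj])
    show "v \<in> f ` I"
      using R(2) range by blast
    show "E `` (f ` I) \<subseteq> f ` I"
      using closed f range by blast
    show "(\<forall>i\<in>I. \<forall>j\<in>I. (f i, f j) \<in> E \<longleftrightarrow> \<bar>i - j\<bar> = 1) \<or>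
     (\<exists>a b. a + 2 \<le> b \<and> I = {a..b} \<and>
       (\<forall>i\<in>I. \<forall>j\<in>I. (f i, f j) \<in> E \<longleftrightarrow> \<bar>i - j\<bar> = 1 \<or> {i, j} = {a, b}))"
    proof (cases "\<exists>a\<in>I. \<exists>b\<in>I. a + 2 \<le> b \<and> (f a, f b) \<in> E")
      case True
      then obtain a b where ab: "a \<in> I" "b \<in> I" "a + 2 \<le> b" "(f a, f b) \<in> E"
        by blast
      \<comment> \<open>A chord forces its positions to be the extreme ones, so \<open>I\<close> is
        the finite interval between them and there is no second chord.\<close>
      have bounds: "i - 1 \<notin> I \<and> j + 1 \<notin> I"
        if "i \<in> I" "j \<in> I" "i + 2 \<le> j" "(f i, f j) \<in> E" for i j
        using ends[OF f f] that unfolding I_def by fastforce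
      have upper: "i \<le> b'" if "b' \<in> I" "b' + 1 \<notin> I" "i \<in> I" for b' i
      proof (rule ccontr)
        assume "\<not> i \<le> b'"
        then have "b' + 1 \<in> {b'..i}" by simp
        then show False
          using int that by blast
      qed
      have lower: "a' \<le> i" if "a' \<in> I" "a' - 1 \<notin> I" "i \<in> I" for a' i
      proof (rule ccontr)
        assume "\<not> a' \<le> i"
        then have "a' - 1 \<in> {i..a'}" by simp
        then show False
          using int that by blast
      qed
      have I: "I = {a..b}"
        using int ab(1,2) upper[of b] lower[of a] bounds[OF ab] by auto
      have far: "i = a \<and> j = b" if "i \<in> I" "j \<in> I" "i + 2 \<le> j" "(f i, f j) \<in> E" for i j
        using bounds[OF that] that(1,2) unfolding I by auto
      have "(f i, f j) \<in> E \<longleftrightarrow> \<bar>i - j\<bar> = 1 \<or> {i, j} = {a, b}" if ij: "i \<in> I" "j \<in> I" for i j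
      proof
        assume E: "(f i, f j) \<in> E"
        then have "(f j, f i) \<in> E" "i \<noteq> j"
          using \<open>sym E\<close> irrefl by (auto dest: symD)
        then show "\<bar>i - j\<bar> = 1 \<or> {i, j} = {a, b}"
          using far[OF ij _ E] far[OF ij(2,1)] by force
      next
        assume "\<bar>i - j\<bar> = 1 \<or> {i, j} = {a, b}"
        then show "(f i, f j) \<in> E"
          using adj[OF ij] ab(4) \<open>sym E\<close> by (auto simp: doubleton_eq_iff dest: symD)
      qed
      then show ?thesis
        using ab(3) I by blast
    next
      case False
      have "\<bar>i - j\<bar> = 1" if ij: "i \<in> I" "j \<in> I" "(f i, f j) \<in> E" for i j
      proof -
        have "(f j, f i) \<in> E" "i \<noteq> j"
          using \<open>sym E\<close> irrefl ij(3) by (auto dest: symD)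
        moreover from this have "\<not> i + 2 \<le> j" "\<not> j + 2 \<le> i"
          using False ij by blast+
        ultimately show ?thesis
          by linarith
      qed
      then show ?thesis
        using adj by (intro disjI1) metis
    qed
  qed
qed

section \<open>From the square of a graph to its components and back\<close>

lemma pair_wf_digraph_path_on: "pair_wf_digraph (path_on I)"
  by unfold_locales (auto simp: path_on_def)

lemma pair_wf_digraph_cycle_on: "pair_wf_digraph (cycle_on n)"
  by unfold_locales (auto simp: cycle_on_def)

text \<open>The induced subgraph as a pair digraph, so that the description of isomorphisms by
  vertex bijections applies to components.\<close>

definition restrict_pair :: "'a pair_pre_digraph \<Rightarrow> 'a set \<Rightarrow> 'a pair_pre_digraph" where
  "restrict_pair G S = \<lparr>pverts = S, parcs = parcs G \<inter> S \<times> S\<rparr>"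

lemma pair_wf_digraph_restrict_pair: "pair_wf_digraph (restrict_pair G S)"
  by unfold_locales (auto simp: restrict_pair_def)

text \<open>Since the vertex set \<open>S\<close> is closed under adjacency, the common neighbour
  behind an arc of the square lies in \<open>S\<close> too, so the isomorphism preserves that
  arc.\<close>

lemma cyclic_seq_square_iso:
  assumes g: "cyclic_seq (square (parcs G)) n g" and sub: "g ` {..<n} \<subseteq> S"
    and closed: "parcs G `` S \<subseteq> S"
    and iso: "digraph_iso (with_proj (restrict_pair G S)) (with_proj H)" and "pair_wf_digraph H"
  shows "\<exists>h. cyclic_seq (square (parcs H)) n h"
proof -
  obtain \<phi> where \<phi>: "inj_on \<phi> S"
      "\<And>u v. u \<in> S \<Longrightarrow> v \<in> S \<Longrightarrow> (u, v) \<in> parcs G \<Longrightarrow> (\<phi> u, \<phi> v) \<in> parcs H"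
    using iso
    unfolding digraph_iso_with_proj_iff[OF pair_wf_digraph_restrict_pair \<open>pair_wf_digraph H\<close>]
    by (auto simp: restrict_pair_def bij_betw_def)
  have "(\<phi> u, \<phi> w) \<in> square (parcs H)" if "u \<in> S" "w \<in> S" "(u, w) \<in> square (parcs G)" for u w
  proof -
    from that(3) obtain v where "u \<noteq> w" "(u, v) \<in> parcs G" "(v, w) \<in> parcs G"
      by (auto simp: square_def)
    moreover from this have "v \<in> S"
      using closed that(1) by blast
    ultimately show ?thesis
      using \<phi> that(1,2) unfolding square_def by (auto dest: inj_onD)
  qed
  then have "cyclic_seq (square (parcs H)) n (\<phi> \<circ> g)"
    using sub by (intro cyclic_seq_map[OF g inj_on_subset[OF \<phi>(1)]]) blast+
  then show ?thesis by blast
qed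

lemma connected_components_with_proj:
  assumes "pair_wf_digraph G"
  shows "connected_components (with_proj G) =
    (\<lambda>v. with_proj (restrict_pair G (pre_digraph.scc_of (with_proj G) v))) ` pverts G"
proof -
  interpret pair_wf_digraph G by fact
  have "with_proj G \<restriction> S = with_proj (restrict_pair G S)" for S
    by (auto simp: induce_subgraph_def with_proj_def restrict_pair_def)
  then show ?thesis
    unfolding connected_components_def sccs_conv_sccs_verts sccs_verts_conv_scc_of image_image
    by simp
qed

text \<open>The graph-theoretic core, free of arithmetic; it will be applied to B(X), whose square
  combines \<Gamma>(X) and \<Delta>(X).\<close>

lemma square_acyclic_iff_components:
  assumes "pair_bidirected_digraph G"
  shows "(\<nexists>n g. cyclic_seq (square (parcs G)) n g) \<longleftrightarrow>
    (\<forall>C \<in> connected_components (with_proj G). is_path C \<or> is_cycle_of_length 4 C)"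
proof
  interpret pair_bidirected_digraph G by fact
  let ?E = "parcs G"
  have sym: "sym ?E"
    by (auto intro: symI arcs_symmetric)
  have irrefl: "(u, u) \<notin> ?E" for u
    using no_loops by force
  \<comment> \<open>Arcs come in opposite pairs, so one arc already puts both ends into the same
    strong component.\<close>
  have step: "v \<in> scc_of w" if "u \<in> scc_of w" "(u, v) \<in> ?E" for u v w
  proof -
    have "u \<in> scc_of v"
      using that(2) by (intro scc_ofI_reachable) auto
    then show ?thesis
      using that(1) scc_of_eq by (metis in_arcsD2 in_scc_of_self that(2))
  qed
  {
    assume acyc: "\<nexists>n g. cyclic_seq (square ?E) n g"
    have deg: "a = b \<or> a = c \<or> b = c" if "(v, a) \<in> ?E" "(v, b) \<in> ?E" "(v, c) \<in> ?E" for v a b c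
    proof (rule ccontr)
      assume neq: "\<not> ?thesis"
      define t where "t i = (if i = 0 then a else if i = 1 then b else c)" for i :: nat
      have "(a, b) \<in> square ?E" "(b, c) \<in> square ?E" "(c, a) \<in> square ?E"
        using that that[THEN symD[OF sym]] neq unfolding square_def by blast+
      then have "(t 0, t 1) \<in> square ?E" "(t 1, t 2) \<in> square ?E" "(t 2, t 0) \<in> square ?E"
        by (simp_all add: t_def)
      moreover have "i = 0 \<or> i = 1 \<or> i = 2" if "i < 3" for i :: nat
        using that by auto
      ultimately have "(t i, t (Suc i mod 3)) \<in> square ?E" if "i < 3" for i
        using that by (fastforce simp: numeral_2_eq_2)
      moreover have "inj_on t {..<3}"
        using neq \<open>\<And>i. i < 3 \<Longrightarrow> i = 0 \<or> i = 1 \<or> i = 2\<close> by (auto simp: inj_on_def t_def)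
      ultimately have "cyclic_seq (square ?E) 3 t"
        by (simp add: cyclic_seq_def)
      then show False
        using acyc by blast
    qed
    show "\<forall>C \<in> connected_components (with_proj G). is_path C \<or> is_cycle_of_length 4 C"
    proof
      fix C assume "C \<in> connected_components (with_proj G)"
      then obtain v where v: "v \<in> pverts G" and C: "C = with_proj (restrict_pair G (scc_of v))"
        by (auto simp: connected_components_with_proj[OF pair_wf_digraph_axioms])
      obtain I :: "int set" and f where I: "\<forall>i\<in>I. \<forall>k\<in>I. {i..k} \<subseteq> I" and f: "inj_on f I" "v \<in> f ` I"
        and closed: "?E `` (f ` I) \<subseteq> f ` I"
        and shape: "(\<forall>i\<in>I. \<forall>j\<in>I. (f i, f j) \<in> ?E \<longleftrightarrow> \<bar>i - j\<bar> = 1) \<or>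
         (\<exists>a b. a + 2 \<le> b \<and> I = {a..b} \<and>
           (\<forall>i\<in>I. \<forall>j\<in>I. (f i, f j) \<in> ?E \<longleftrightarrow> \<bar>i - j\<bar> = 1 \<or> {i, j} = {a, b}))"
        by (rule component_of_max_degree_2[OF sym irrefl deg, where v = v])
      have adj: "(f i, f (i + 1)) \<in> ?E" if "i \<in> I" "i + 1 \<in> I" for i
        using shape that by auto
      have "scc_of v \<subseteq> f ` I"
      proof
        fix u assume "u \<in> scc_of v"
        then have "v \<rightarrow>\<^sup>*\<^bsub>with_proj G\<^esub> u"
          by (simp add: scc_of_def)
        then show "u \<in> f ` I"
          by (induction rule: reachable_induct) (use f(2) closed in auto)
      qed
      \<comment> \<open>Walk from the position of \<open>v\<close> in both directions; as
        \<open>I\<close> is an interval, all positions on the way belong to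
        \<open>I\<close>.\<close>
      moreover have "f ` I \<subseteq> scc_of v"
      proof -
        obtain i0 where i0: "i0 \<in> I" "f i0 = v"
          using f(2) by blast
        have "f i \<in> scc_of v" if "i \<in> I" for i
          using that
        proof (induction i rule: int_induct[of _ i0])
          case base
          then show ?case
            using i0(2) in_scc_of_self[OF v] by simp
        next
          case (step1 i)
          then have "i \<in> {i0..i + 1}" by simp
          then have "i \<in> I"
            using I i0(1) step1.prems by blast
          then show ?case
            using step step1.IH adj step1.prems by blast
        next
          case (step2 i)
          then have "i \<in> {i - 1..i0}" by simp
          then have "i \<in> I"
            using I i0(1) step2.prems by blast
          then show ?case
            using step[OF step2.IH] adj[of "i - 1"] step2.prems sym by (auto dest: symD)
        qed
        then show ?thesis by blast
      qed
      ultimately have S: "scc_of v = f ` I" ..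
      let ?C = "restrict_pair G (scc_of v)"
      define h where "h = the_inv_into I f"
      have h: "bij_betw h (scc_of v) I"
        unfolding S h_def using f(1) by (simp add: bij_betw_the_inv_into inj_on_imp_bij_betw)
      have hf: "h (f i) = i" if "i \<in> I" for i
        using that f(1) by (simp add: h_def the_inv_into_f_f)
      from shape show "is_path C \<or> is_cycle_of_length 4 C"
      proof
        assume path: "\<forall>i\<in>I. \<forall>j\<in>I. (f i, f j) \<in> ?E \<longleftrightarrow> \<bar>i - j\<bar> = 1"
        have "digraph_iso (with_proj ?C) (with_proj (path_on I))"
          unfolding digraph_iso_with_proj_iff[OF pair_wf_digraph_restrict_pair pair_wf_digraph_path_on]
          using h path by (intro exI[of _ h]) (auto simp: restrict_pair_def path_on_def S hf)
        then show ?thesis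
          using I f(2) unfolding is_path_def C by blast
      next
        assume "\<exists>a b. a + 2 \<le> b \<and> I = {a..b} \<and>
           (\<forall>i\<in>I. \<forall>j\<in>I. (f i, f j) \<in> ?E \<longleftrightarrow> \<bar>i - j\<bar> = 1 \<or> {i, j} = {a, b})"
        then obtain a b where ab: "a + 2 \<le> b" "I = {a..b}"
          and E: "\<And>i j. i \<in> I \<Longrightarrow> j \<in> I \<Longrightarrow> (f i, f j) \<in> ?E \<longleftrightarrow> \<bar>i - j\<bar> = 1 \<or> {i, j} = {a, b}"
          by blast
        \<comment> \<open>\<open>n\<close> counts the integers from \<open>a\<close> to
          \<open>b\<close>; the arc between the two ends closes the sequence.\<close>
        define n where "n = nat (b - a + 1)"
        have n: "3 \<le> n" "b = a + int n - 1"
          using ab(1) by (auto simp: n_def)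
        have mem: "a + int k \<in> I" if "k < n" for k
          using that n by (auto simp: ab(2))
        have "cyclic_seq ?E n (\<lambda>k. f (a + int k))"
          unfolding cyclic_seq_def
        proof (intro conjI allI impI)
          show "inj_on (\<lambda>k. f (a + int k)) {..<n}"
          proof (rule inj_onI)
            fix k l assume "k \<in> {..<n}" "l \<in> {..<n}" "f (a + int k) = f (a + int l)"
            then show "k = l"
              using inj_onD[OF f(1) _ mem mem, of k l] by simp
          qed
          fix k assume "k < n"
          then have "Suc k mod n < n" by simp
          then show "(f (a + int k), f (a + int (Suc k mod n))) \<in> ?E"
            using E[OF mem mem] \<open>k < n\<close> n by (auto simp: mod_Suc)
        qed (fact n)
        then have "n = 4"
          using cyclic_seq_square acyc by blast
        define h' where "h' = (\<lambda>u. nat (h u - a))"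
        have "bij_betw (\<lambda>i. nat (i - a)) I {..<4}"
          using n \<open>n = 4\<close> ab(2)
          by (intro bij_betw_byWitness[where f' = "\<lambda>k. a + int k"]) auto
        then have h': "bij_betw h' (scc_of v) {..<4}"
          using bij_betw_trans[OF h] by (simp add: h'_def comp_def)
        have "digraph_iso (with_proj ?C) (with_proj (cycle_on 4))"
          unfolding digraph_iso_with_proj_iff[OF pair_wf_digraph_restrict_pair pair_wf_digraph_cycle_on]
        proof (intro exI[of _ h'] conjI ballI)
          show "bij_betw h' (pverts ?C) (pverts (cycle_on 4))"
            using h' by (simp add: restrict_pair_def cycle_on_def)
          fix u w assume "u \<in> pverts ?C" "w \<in> pverts ?C"
          then obtain i j where ij: "i \<in> I" "u = f i" "j \<in> I" "w = f j"
            by (auto simp: restrict_pair_def S)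
          then obtain k l where kl: "i = a + int k" "k < 4" "j = a + int l" "l < 4"
            using n \<open>n = 4\<close> ab(2) zle_iff_zadd[of a i] zle_iff_zadd[of a j] by auto
          have consec: "\<bar>i - j\<bar> = 1 \<longleftrightarrow> l = Suc k \<or> k = Suc l"
            using kl by linarith
          \<comment> \<open>After the shift by \<open>a\<close> the closing arc joins 0 and 3, the
            wrap-around pair modulo 4.\<close>
          have ends: "{i, j} = {a, b} \<longleftrightarrow> k = 0 \<and> l = 3 \<or> k = 3 \<and> l = 0"
            using kl n(2) \<open>n = 4\<close> by (auto simp: doubleton_eq_iff)
          have "Suc k mod 4 = (if k = 3 then 0 else Suc k)" "Suc l mod 4 = (if l = 3 then 0 else Suc l)"
            using kl by (simp_all add: mod_Suc)
          then have cyc: "(k, l) \<in> parcs (cycle_on 4) \<longleftrightarrow>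
              l = Suc k \<or> k = Suc l \<or> k = 0 \<and> l = 3 \<or> k = 3 \<and> l = 0"
            using kl by (auto simp: cycle_on_def)
          have "(u, w) \<in> parcs ?C \<longleftrightarrow> \<bar>i - j\<bar> = 1 \<or> {i, j} = {a, b}"
            using E ij by (auto simp: restrict_pair_def S)
          also have "\<dots> \<longleftrightarrow> (k, l) \<in> parcs (cycle_on 4)"
            unfolding consec ends cyc by blast
          also have "(k, l) = (h' u, h' w)"
            using ij kl hf by (auto simp: h'_def)
          finally show "(u, w) \<in> parcs ?C \<longleftrightarrow> (h' u, h' w) \<in> parcs (cycle_on 4)" .
        qed
        then show ?thesis
          by (simp add: is_cycle_of_length_def C)
      qed
    qed
  next
    assume comps: "\<forall>C \<in> connected_components (with_proj G). is_path C \<or> is_cycle_of_length 4 C"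
    show "\<nexists>n g. cyclic_seq (square ?E) n g"
    proof (intro notI, elim exE)
      fix n g assume g: "cyclic_seq (square ?E) n g"
      define S where "S = scc_of (g 0)"
      have n: "3 \<le> n" and arcs: "\<And>i. i < n \<Longrightarrow> (g i, g (Suc i mod n)) \<in> square ?E"
        using g by (auto simp: cyclic_seq_def)
      have "g 0 \<in> pverts G"
        using arcs[of 0] n by (auto simp: square_def dest: in_arcsD1)
      then have C: "with_proj (restrict_pair G S) \<in> connected_components (with_proj G)"
        and g0: "g 0 \<in> S"
        by (auto simp: S_def connected_components_with_proj[OF pair_wf_digraph_axioms] in_scc_of_self)
      \<comment> \<open>An arc of the square consists of two arcs of \<open>G\<close>, so the
        sequence never leaves the component of \<open>g 0\<close>.\<close>
      have "g i \<in> S" if "i < n" for i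
        using that
      proof (induction i)
        case (Suc i)
        then have "(g i, g (Suc i)) \<in> square ?E"
          using arcs[of i] by simp
        then obtain y where y: "(g i, y) \<in> ?E" "(y, g (Suc i)) \<in> ?E"
          by (auto simp: square_def)
        show ?case
          using step[OF step[OF _ y(1)] y(2)] Suc by (simp add: S_def)
      qed (use g0 in simp)
      then have sub: "g ` {..<n} \<subseteq> S"
        by blast
      have "?E `` S \<subseteq> S"
        using step unfolding S_def by blast
      note transport = cyclic_seq_square_iso[OF g sub this]
      from comps C have "is_path (with_proj (restrict_pair G S)) \<or>
          is_cycle_of_length 4 (with_proj (restrict_pair G S))"
        by blast
      then show False
      proof
        assume "is_path (with_proj (restrict_pair G S))"
        then obtain I where "digraph_iso (with_proj (restrict_pair G S)) (with_proj (path_on I))"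
          unfolding is_path_def by blast
        then show False
          using transport[OF _ pair_wf_digraph_path_on] no_cyclic_seq_square_path_on by blast
      next
        assume "is_cycle_of_length 4 (with_proj (restrict_pair G S))"
        then show False
          using transport[OF _ pair_wf_digraph_cycle_on] no_cyclic_seq_square_cycle_on_4
          unfolding is_cycle_of_length_def by blast
      qed
    qed
  }
qed

section \<open>\<Gamma>(X) and \<Delta>(X) as the two sides of the square of B(X)\<close>

text \<open>A common neighbour of distinct \<open>x\<close> and \<open>y\<close> in B(X) is a prime
  dividing both, which exists exactly if their gcd exceeds 1.\<close>

lemma common_divisor_graph_arc_iff:
  "(x, y) \<in> parcs (common_divisor_graph X) \<longleftrightarrow>
    (Inr x, Inr y) \<in> square (parcs (bipartite_divisor_graph X))"
proof -
  have "1 < gcd x y \<longleftrightarrow> (\<exists>p. prime p \<and> p dvd x \<and> p dvd y)" if "x \<noteq> y"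
  proof
    assume "1 < gcd x y"
    then obtain p where "prime p" "p dvd gcd x y"
      by (metis less_numeral_extra(4) prime_factor_nat)
    then show "\<exists>p. prime p \<and> p dvd x \<and> p dvd y"
      by auto
  next
    assume "\<exists>p. prime p \<and> p dvd x \<and> p dvd y"
    then obtain p where "prime p" "p dvd gcd x y"
      by auto
    \<comment> \<open>Distinct numbers are not both 0, so the gcd is at least as large as the prime
      dividing it.\<close>
    moreover have "gcd x y \<noteq> 0"
      using that by (metis gcd_eq_0_iff)
    ultimately show "1 < gcd x y"
      by (metis gr0I less_le_trans dvd_imp_le prime_gt_1_nat)
  qed
  then show ?thesis
    by (auto simp: common_divisor_graph_def square_def bipartite_divisor_graph_def rho_def star_def relcomp_unfold)
qed

text \<open>Distinct primes are coprime, so their product divides a number as soon as both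
  do.\<close>

lemma prime_vertex_graph_arc_iff:
  "(p, q) \<in> parcs (prime_vertex_graph X) \<longleftrightarrow>
    (Inl p, Inl q) \<in> square (parcs (bipartite_divisor_graph X))"
proof -
  have "p * q dvd x \<longleftrightarrow> p dvd x \<and> q dvd x" if "prime p" "prime q" "p \<noteq> q" for x
    using that by (meson divides_mult dvd_mult_left dvd_mult_right primes_coprime)
  \<comment> \<open>A witness in \<open>X\<close> divisible by a prime therefore lies in
    \<open>star X\<close> and is a vertex of B(X).\<close>
  moreover have "x \<noteq> 1" if "p dvd x" "prime p" for x
    using that by auto
  ultimately show ?thesis
    by (auto simp: prime_vertex_graph_def square_def bipartite_divisor_graph_def rho_def star_def relcomp_unfold)
qed

text \<open>Every arc of B(X) changes sides, so two arcs lead back.\<close>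

lemma square_bipartite_divisor_graph_same_side:
  assumes "(u, w) \<in> square (parcs (bipartite_divisor_graph X))"
  shows "isl u \<longleftrightarrow> isl w"
  using assms by (auto simp: square_def bipartite_divisor_graph_def)

lemma cyclic_seq_isl_iff:
  assumes "cyclic_seq E n g" and "\<And>u w. (u, w) \<in> E \<Longrightarrow> isl u \<longleftrightarrow> isl w" and "i < n"
  shows "isl (g i) \<longleftrightarrow> isl (g 0)"
  using \<open>i < n\<close>
proof (induction i)
  case (Suc i)
  then have "(g i, g (Suc i)) \<in> E"
    using assms(1) by (metis Suc_lessD cyclic_seq_def mod_less)
  then show ?case
    using Suc assms(2) by simp
qed simp

text \<open>A cycle in the square stays on one side, so removing the tags gives a cycle in
  \<Delta>(X) or in \<Gamma>(X); adding them reverses this.\<close>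

lemma cyclic_seq_square_bipartite_divisor_graph_iff:
  "(\<exists>n g. cyclic_seq (square (parcs (bipartite_divisor_graph X))) n g) \<longleftrightarrow>
    (\<exists>n g. cyclic_seq (parcs (common_divisor_graph X)) n g) \<or>
    (\<exists>n g. cyclic_seq (parcs (prime_vertex_graph X)) n g)"
  (is "?B \<longleftrightarrow> ?\<Gamma> \<or> ?\<Delta>")
proof
  assume ?B
  then obtain n g where g: "cyclic_seq (square (parcs (bipartite_divisor_graph X))) n g"
    by blast
  have side: "isl (g i) \<longleftrightarrow> isl (g 0)" if "i < n" for i
    using cyclic_seq_isl_iff[OF g square_bipartite_divisor_graph_same_side that] .
  show "?\<Gamma> \<or> ?\<Delta>"
  proof (cases "isl (g 0)")
    case True
    \<comment> \<open>On the visited vertices \<open>projl\<close> is undone by \<open>Inl\<close>,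
      hence it is injective there.\<close>
    then have "u = Inl (projl u)" if "u \<in> g ` {..<n}" for u
      using that side by auto
    then have "cyclic_seq (parcs (prime_vertex_graph X)) n (projl \<circ> g)"
      by (intro cyclic_seq_map[OF g]) (metis inj_onI, metis prime_vertex_graph_arc_iff)
    then show ?thesis by blast
  next
    case False
    then have "u = Inr (projr u)" if "u \<in> g ` {..<n}" for u
      using that side by auto
    then have "cyclic_seq (parcs (common_divisor_graph X)) n (projr \<circ> g)"
      by (intro cyclic_seq_map[OF g]) (metis inj_onI, metis common_divisor_graph_arc_iff)
    then show ?thesis by blast
  qed
next
  assume "?\<Gamma> \<or> ?\<Delta>"
  then show ?B
  proof (elim disjE exE)
    fix n g assume "cyclic_seq (parcs (common_divisor_graph X)) n g"
    then have "cyclic_seq (square (parcs (bipartite_divisor_graph X))) n (Inr \<circ> g)"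
      by (rule cyclic_seq_map) (auto simp: common_divisor_graph_arc_iff)
    then show ?B by blast
  next
    fix n g assume "cyclic_seq (parcs (prime_vertex_graph X)) n g"
    then have "cyclic_seq (square (parcs (bipartite_divisor_graph X))) n (Inl \<circ> g)"
      by (rule cyclic_seq_map) (auto simp: prime_vertex_graph_arc_iff)
    then show ?B by blast
  qed
qed

theorem theorem4p2:
  fixes X :: "nat set"
  assumes "X \<noteq> {}" and "\<forall>x\<in>X. 0 < x" and "X \<noteq> {1}"
  shows "acyclic_graph (with_proj (common_divisor_graph X)) \<and>
         acyclic_graph (with_proj (prime_vertex_graph X)) \<longleftrightarrow>
         (\<forall>C \<in> connected_components (with_proj (bipartite_divisor_graph X)).
            is_path C \<or> is_cycle_of_length 4 C)"
proof -
  have "pair_wf_digraph (common_divisor_graph X)" "pair_wf_digraph (prime_vertex_graph X)"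
    using pair_bidirected_common_divisor_graph[of X] pair_bidirected_prime_vertex_graph[of X]
    by (auto simp: pair_bidirected_digraph_def pair_sym_digraph_def)
  then show ?thesis
    using square_acyclic_iff_components[OF pair_bidirected_bipartite_divisor_graph, of X]
      cyclic_seq_square_bipartite_divisor_graph_iff[of X]
    by (simp add: acyclic_graph_iff_cyclic_seq)
qed

end
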